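(* Let $I\ge 3$ be an integer and let $\mathcal{N}_1,\dots,\mathcal{N}_I\in\mathbb{R}$; indices are taken modulo $I$. Consider all splittings $(\mathcal{N}_i^+,\mathcal{N}_i^-)_{1\le i\le I}$ of real numbers with $\mathcal{N}_i=\mathcal{N}_i^++\mathcal{N}_i^-$ for all $i$, and the functional $$F=\sum_{i=1}^I\left|\mathcal{N}_i^++\mathcal{N}_{i+1}^-\right|^2 .$$ Let $(\mu_k)_{k\in\mathbb{Z}}$ be the $I$-periodic sequence with $\mu_k=\frac{I-1}{2I}-\frac{k}{I}$ for $k=0,\dots,I-1$. Then: (1) the splittings minimizing $F$ are exactly those of the form $$\mathcal{N}_i^-=c+\sum_{i'=1}^I\mu_{i'-i}\,\mathcal{N}_{i'},\qquad \mathcal{N}_i^+=\mathcal{N}_i-\mathcal{N}_i^-\qquad(1\le i\le I),$$ with $c\in\mathbb{R}$ an arbitrary constant independent of $i$, and the choice $c=0$ is the unique minimizer for which $(\mathcal{N}_i^-)_{1\le i\le I}$ is orthogonal to $(1,\dots,1)^T$; (2) all minimizing splittings give rise to the same transmitted values: for every minimizing splitting and every $i$, $$-\mathcal{N}_{i+1}^--\mathcal{N}_{i-1}^+=\mathcal{N}_i-\frac{2}{I}\sum_{i'=1}^I\mathcal{N}_{i'} .$$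
   Context: Interpretation only (not needed for the claim): $\mathcal{N}_i$ is the discrete (variational) Neumann value of subdomain $\Omega_i$ at a cross-point where $I$ subdomains, numbered cyclically, meet; $\mathcal{N}_i^+$ and $\mathcal{N}_i^-$ are the parts attributed to the edges shared with $\Omega_{i+1}$ and $\Omega_{i-1}$ respectively, $F$ measures the Neumann jumps, and $-\mathcal{N}_{i+1}^--\mathcal{N}_{i-1}^+$ is the Neumann contribution sent to $\Omega_i$. *)

theory Defs
  imports Complex_Main "HOL-Library.Periodic_Fun"
begin

text \<open>
  A family indexed by \<open>1, \<dots>, I\<close> with indices taken modulo \<open>I\<close> is represented by an
  \<open>I\<close>-periodic function on the integers; it is determined by its values on \<open>{1..I}\<close>.
  A pair \<open>(P, M)\<close> stands for the splitting with plus parts \<open>P i\<close> and minus parts \<open>M i\<close>.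
\<close>

definition splitting ::
    "int \<Rightarrow> (int \<Rightarrow> real) \<Rightarrow> (int \<Rightarrow> real) \<times> (int \<Rightarrow> real) \<Rightarrow> bool" where
  "splitting I N = (\<lambda>(P, M). periodic_fun_simple P I \<and> periodic_fun_simple M I \<and>
     (\<forall>i\<in>{1..I}. N i = P i + M i))"

definition jump_functional :: "int \<Rightarrow> (int \<Rightarrow> real) \<times> (int \<Rightarrow> real) \<Rightarrow> real" where
  "jump_functional I = (\<lambda>(P, M). \<Sum>i=1..I. \<bar>P i + M (i + 1)\<bar>\<^sup>2)"

definition minimizing_splitting ::
    "int \<Rightarrow> (int \<Rightarrow> real) \<Rightarrow> (int \<Rightarrow> real) \<times> (int \<Rightarrow> real) \<Rightarrow> bool" where
  "minimizing_splitting I N = is_arg_min (jump_functional I) (splitting I N)"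

definition mu_splitting ::
    "int \<Rightarrow> (int \<Rightarrow> real) \<Rightarrow> (int \<Rightarrow> real) \<Rightarrow> real \<Rightarrow> (int \<Rightarrow> real) \<times> (int \<Rightarrow> real) \<Rightarrow> bool" where
  "mu_splitting I mu N c = (\<lambda>(P, M). periodic_fun_simple P I \<and> periodic_fun_simple M I \<and>
     (\<forall>i\<in>{1..I}. M i = c + (\<Sum>i'=1..I. mu (i' - i) * N i') \<and> P i = N i - M i))"

definition cyclic_inner :: "int \<Rightarrow> (int \<Rightarrow> real) \<Rightarrow> (int \<Rightarrow> real) \<Rightarrow> real" where
  "cyclic_inner I u v = (\<Sum>i=1..I. u i * v i)"

end

(*
  Put d i = P i + M (i + 1). Summing over a period gives sum d = sum N =: S for every splitting, so
  F = sum d^2 = S^2/I + sum (d - S/I)^2, and the minimum is attained exactly when all d i equal S/I,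
  i.e. when M solves M (i + 1) - M i = S/I - N i. The sequence mu (-i) solves this difference equation
  for N = delta_0 and has zero sum, so convolution with mu yields a solution with zero sum; any two
  periodic solutions differ by a constant.
*)
theory Submission
  imports Defs
begin

section \<open>Periodic functions on the integers and their sums over one period\<close>

lemma periodic_fun_int_mod:
  fixes f :: "int \<Rightarrow> 'a" and I :: int
  assumes "periodic_fun_simple f I"
  shows "f (i mod I) = f i"
proof -
  interpret periodic_fun_simple f I by fact
  have "f (i mod I) = f (i - of_int (i div I) * I)"
    by (simp add: minus_div_mult_eq_mod)
  then show ?thesis by (simp only: minus_of_int)
qed

lemma periodic_fun_eqI:
  fixes f g :: "int \<Rightarrow> 'a" and I :: int
  assumes "periodic_fun_simple f I" "periodic_fun_simple g I" "I \<ge> 1"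
    and eq: "\<And>i. i \<in> {1..I} \<Longrightarrow> f i = g i"
  shows "f i = g i"
proof (cases "i mod I = 0")
  \<comment> \<open>The residue 0 lies outside \<open>{1..I}\<close>; its representative there is
    \<open>I\<close> itself.\<close>
  case True
  have "f I = f i" "g I = g i"
    using periodic_fun_int_mod[OF assms(1), of I] periodic_fun_int_mod[OF assms(1), of i]
      periodic_fun_int_mod[OF assms(2), of I] periodic_fun_int_mod[OF assms(2), of i] True
    by simp_all
  then show ?thesis using eq[of I] \<open>I \<ge> 1\<close> by simp
next
  case False
  moreover have "0 \<le> i mod I" "i mod I < I" using \<open>I \<ge> 1\<close> by simp_all
  ultimately have "f (i mod I) = g (i mod I)" by (intro eq) simp
  then show ?thesis by (simp add: periodic_fun_int_mod[OF assms(1)] periodic_fun_int_mod[OF assms(2)])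
qed

lemma periodic_fun_simpleI:
  fixes f :: "int \<Rightarrow> 'a"
  assumes "\<And>i. f (i + I) = f i"
  shows "periodic_fun_simple f I"
  using assms by unfold_locales

lemma periodic_fun_shift:
  fixes f :: "int \<Rightarrow> 'a"
  assumes "periodic_fun_simple f I"
  shows "periodic_fun_simple (\<lambda>i. f (i + k)) I"
proof (rule periodic_fun_simpleI)
  fix i
  have "f ((i + k) + I) = f (i + k)" using assms by (rule periodic_fun_simple.plus_period)
  then show "f (i + I + k) = f (i + k)" by (simp add: algebra_simps)
qed

lemma sum_periodic_Suc:
  fixes f :: "int \<Rightarrow> 'a::comm_monoid_add"
  assumes "periodic_fun_simple f I" "I \<ge> 1"
  shows "(\<Sum>i=1..I. f (i + 1)) = (\<Sum>i=1..I. f i)"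
proof -
  have "f (1 + I) = f 1" using assms(1) by (rule periodic_fun_simple.plus_period)
  moreover have "(\<Sum>i=1..I. f (i + 1)) = (\<Sum>i=2..I + 1. f i)"
    by (rule sum.reindex_bij_witness[of _ "\<lambda>i. i - 1" "\<lambda>i. i + 1"]) auto
  moreover have "{2..I + 1} = insert (I + 1) {2..I}" "{1..I} = insert 1 {2..I}"
    using \<open>I \<ge> 1\<close> by auto
  ultimately show ?thesis by (simp add: add.commute)
qed

lemma sum_periodic_shift:
  fixes f :: "int \<Rightarrow> 'a::comm_monoid_add"
  assumes "periodic_fun_simple f I" "I \<ge> 1"
  shows "(\<Sum>i=1..I. f (i + k)) = (\<Sum>i=1..I. f i)"
proof (induction k rule: int_induct[of _ 0])
  case (step1 k)
  then show ?case
    using sum_periodic_Suc[OF periodic_fun_shift[OF assms(1)] assms(2), of k] by (simp add: algebra_simps)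
next
  case (step2 k)
  then show ?case
    using sum_periodic_Suc[OF periodic_fun_shift[OF assms(1)] assms(2), of "k - 1"]
    by (simp add: algebra_simps)
qed simp

lemma sum_periodic_reflect:
  fixes f :: "int \<Rightarrow> 'a::comm_monoid_add"
  assumes "periodic_fun_simple f I" "I \<ge> 1"
  shows "(\<Sum>i=1..I. f (k - i)) = (\<Sum>i=1..I. f i)"
proof -
  \<comment> \<open>Reversing the range by \<open>i\<close> to \<open>I + 1 - i\<close> turns the
    reflection into a shift by \<open>k - I - 1\<close>.\<close>
  have "(\<Sum>i=1..I. f (k - i)) = (\<Sum>i=1..I. f (i + (k - I - 1)))"
    by (rule sum.reindex_bij_witness[of _ "\<lambda>i. I + 1 - i" "\<lambda>i. I + 1 - i"]) auto
  then show ?thesis using sum_periodic_shift[OF assms] by simp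
qed

lemma shift_invariant_int_const:
  fixes f :: "int \<Rightarrow> 'a"
  assumes "\<And>i. f (i + 1) = f i"
  shows "f i = f 0"
proof (induction i rule: int_induct[of _ 0])
  case (step2 i)
  then show ?case using assms[of "i - 1"] by simp
qed (simp_all add: assms)

text \<open>Decomposition into mean and variance. When the sum is prescribed, only the last term can
  vary, and it vanishes exactly for constant \<open>d\<close>.\<close>

lemma sum_squares_eq_mean:
  fixes d :: "'a \<Rightarrow> real"
  assumes "finite A" "A \<noteq> {}"
  shows "(\<Sum>i\<in>A. (d i)\<^sup>2)
    = (sum d A)\<^sup>2 / card A + (\<Sum>i\<in>A. (d i - sum d A / card A)\<^sup>2)"
proof -
  have "card A \<noteq> 0" using assms by simp
  have "(\<Sum>i\<in>A. (d i - sum d A / card A)\<^sup>2)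
    = (\<Sum>i\<in>A. (d i)\<^sup>2) - 2 * (sum d A / card A) * sum d A + card A * (sum d A / card A)\<^sup>2"
    by (simp add: power2_diff sum.distrib sum_subtractf sum_distrib_left sum_distrib_right
      sum_divide_distrib algebra_simps)
  with \<open>card A \<noteq> 0\<close> show ?thesis
    by (simp add: power2_eq_square field_simps)
qed

section \<open>Jumps of a splitting and the lower bound for the functional\<close>

context
  fixes I :: int and N :: "int \<Rightarrow> real"
  assumes I_ge_1: "I \<ge> 1" and N_periodic: "periodic_fun_simple N I"
begin

text \<open>Periodicity carries the constraint from \<open>{1..I}\<close> to all integers, so that
  it is available at neighbours such as \<open>0\<close> and \<open>I + 1\<close>.\<close>

lemma splitting_eq:
  assumes "splitting I N (P, M)"
  shows "P i = N i - M i"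
proof (rule periodic_fun_eqI[OF _ _ I_ge_1])
  show "periodic_fun_simple P I" using assms by (simp add: splitting_def)
  have "periodic_fun_simple M I" using assms by (simp add: splitting_def)
  then show "periodic_fun_simple (\<lambda>i. N i - M i) I"
    by (intro periodic_fun_simpleI) 
      (simp add: periodic_fun_simple.plus_period[OF N_periodic] periodic_fun_simple.plus_period)
qed (use assms in \<open>simp add: splitting_def\<close>)

text \<open>Shifting \<open>M\<close> by one leaves its sum over a period unchanged, so the mean
  jump is the same for every splitting.\<close>

lemma splitting_sum_jumps:
  assumes "splitting I N (P, M)"
  shows "(\<Sum>i=1..I. P i + M (i + 1)) = (\<Sum>i=1..I. N i)"
proof -
  have "periodic_fun_simple M I" using assms by (simp add: splitting_def)
  from sum_periodic_Suc[OF this I_ge_1] show ?thesis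
    by (simp add: splitting_eq[OF assms] sum.distrib sum_subtractf)
qed

text \<open>The optimality condition. It ranges over all integers so that it can be read as a
  recurrence for \<open>M\<close> on the whole line.\<close>

definition equal_jumps :: "(int \<Rightarrow> real) \<Rightarrow> (int \<Rightarrow> real) \<Rightarrow> bool" where
  "equal_jumps P M \<longleftrightarrow> (\<forall>i. P i + M (i + 1) = (\<Sum>j=1..I. N j) / I)"

lemma jump_functional_splitting:
  assumes "splitting I N (P, M)"
  shows "jump_functional I (P, M)
    = (\<Sum>i=1..I. N i)\<^sup>2 / I + (\<Sum>i=1..I. (P i + M (i + 1) - (\<Sum>j=1..I. N j) / I)\<^sup>2)"
  using sum_squares_eq_mean[of "{1..I}" "\<lambda>i. P i + M (i + 1)"] I_ge_1
  unfolding splitting_sum_jumps[OF assms] by (simp add: jump_functional_def)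

lemma jump_functional_ge:
  assumes "splitting I N (P, M)"
  shows "jump_functional I (P, M) \<ge> (\<Sum>i=1..I. N i)\<^sup>2 / I"
  unfolding jump_functional_splitting[OF assms] by (simp add: sum_nonneg)

lemma jump_functional_eq_iff:
  assumes "splitting I N (P, M)"
  shows "jump_functional I (P, M) = (\<Sum>i=1..I. N i)\<^sup>2 / I \<longleftrightarrow> equal_jumps P M"
proof -
  have per: "periodic_fun_simple (\<lambda>i. P i + M (i + 1)) I"
    using periodic_fun_simple.plus_period[of P I] periodic_fun_simple.plus_period[of "\<lambda>i. M (i + 1)" I]
      assms by (intro periodic_fun_simpleI) (simp add: splitting_def periodic_fun_shift)
  have "jump_functional I (P, M) = (\<Sum>i=1..I. N i)\<^sup>2 / I
    \<longleftrightarrow> (\<forall>i\<in>{1..I}. P i + M (i + 1) = (\<Sum>j=1..I. N j) / I)"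
    unfolding jump_functional_splitting[OF assms] by (simp add: sum_nonneg_eq_0_iff)
  also have "\<dots> \<longleftrightarrow> equal_jumps P M"
    unfolding equal_jumps_def
    using periodic_fun_eqI[OF per periodic_fun_simpleI I_ge_1, of "\<lambda>_. (\<Sum>j=1..I. N j) / I"]
    by auto
  finally show ?thesis .
qed

section \<open>The sequence \<open>mu\<close> as a discrete Green's function\<close>

context
  fixes mu :: "int \<Rightarrow> real"
  assumes mu_periodic: "periodic_fun_simple mu I"
    and mu_eq: "\<forall>k\<in>{0..I - 1}. mu k = (real_of_int I - 1) / (2 * real_of_int I) - k / I"
begin

lemma mu_eq_mod: "mu k = (real_of_int I - 1) / (2 * real_of_int I) - (k mod I) / I"
  using mu_eq[rule_format, of "k mod I"] periodic_fun_int_mod[OF mu_periodic, of k] I_ge_1 by simp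

text \<open>Within a period \<open>mu\<close> falls by \<open>1 / I\<close> at each step; at the
  wrap-around from \<open>I - 1\<close> to a multiple of \<open>I\<close> it rises by
  \<open>1 - 1 / I\<close>. This produces the periodic unit impulse.\<close>

lemma mu_diff: "mu (k - 1) - mu k = 1 / I - (if k mod I = 0 then 1 else 0)"
proof (cases "k mod I = 0")
  case True
  then have "(k - 1) mod I = I - 1"
    using I_ge_1 by (metis diff_0 mod_diff_left_eq zmod_minus1 zero_less_one_class.zero_less_one order_less_le_trans)
  with True I_ge_1 show ?thesis by (simp add: mu_eq_mod field_simps)
next
  case False
  moreover have "0 \<le> k mod I" "k mod I < I" using I_ge_1 by simp_all
  ultimately have "(k mod I - 1) mod I = k mod I - 1" by (intro mod_pos_pos_trivial) auto
  then have "(k - 1) mod I = k mod I - 1" by (simp add: mod_diff_left_eq)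
  with False I_ge_1 show ?thesis by (simp add: mu_eq_mod diff_divide_distrib)
qed

lemma sum_mu: "(\<Sum>i=1..I. mu i) = 0"
proof -
  \<comment> \<open>Both sums run over a full period. The indices \<open>i - 1\<close> and
    \<open>I - i\<close> lie in \<open>{0..I - 1}\<close> and add up to \<open>I - 1\<close>, so
    their \<open>mu\<close> values cancel: the constant in \<open>mu\<close> centres it at
    zero.\<close>
  have "2 * (\<Sum>i=1..I. mu i) = (\<Sum>i=1..I. mu (i + - 1)) + (\<Sum>i=1..I. mu (I - i))"
    by (simp only: sum_periodic_shift[OF mu_periodic I_ge_1] sum_periodic_reflect[OF mu_periodic I_ge_1])
  also have "\<dots> = (\<Sum>i=1..I. mu (i - 1) + mu (I - i))"
    by (simp add: sum.distrib)
  also have "\<dots> = (\<Sum>i=1..I. 0)"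
    using I_ge_1 by (intro sum.cong refl) (simp add: mu_eq field_simps)
  finally show ?thesis by simp
qed

text \<open>Cyclic convolution of \<open>N\<close> with the reflected sequence
  \<open>mu (- k)\<close>: the candidate minus part for \<open>c = 0\<close>.\<close>

definition mu_conv :: "int \<Rightarrow> real" where
  "mu_conv i = (\<Sum>j=1..I. mu (j - i) * N j)"

lemma mu_conv_periodic: "periodic_fun_simple mu_conv I"
proof (rule periodic_fun_simpleI)
  fix i
  have "mu (j - (i + I)) = mu (j - i)" for j
    using periodic_fun_simple.plus_period[OF mu_periodic, of "j - (i + I)"] by simp
  then show "mu_conv (i + I) = mu_conv i" by (simp add: mu_conv_def)
qed

text \<open>This is the recurrence that equal jumps impose on \<open>M\<close>. The impulse in
  \<open>mu_diff\<close>, taken at \<open>j - i\<close>, extracts the term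
  \<open>N i\<close>.\<close>

lemma mu_conv_step: "mu_conv (i + 1) = mu_conv i + (\<Sum>j=1..I. N j) / I - N i"
proof (rule periodic_fun_eqI[OF _ _ I_ge_1])
  show "periodic_fun_simple (\<lambda>i. mu_conv (i + 1)) I" by (rule periodic_fun_shift[OF mu_conv_periodic])
  show "periodic_fun_simple (\<lambda>i. mu_conv i + (\<Sum>j=1..I. N j) / I - N i) I"
    by (intro periodic_fun_simpleI)
      (simp add: periodic_fun_simple.plus_period[OF N_periodic]
        periodic_fun_simple.plus_period[OF mu_conv_periodic])
next
  fix i assume i: "i \<in> {1..I}"
  have "mu_conv (i + 1) - mu_conv i = (\<Sum>j=1..I. (mu (j - i - 1) - mu (j - i)) * N j)"
    by (simp add: mu_conv_def sum_subtractf algebra_simps)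
  also have "\<dots> = (\<Sum>j=1..I. N j / I - (if j = i then N j else 0))"
  proof (intro sum.cong refl)
    fix j assume "j \<in> {1..I}"
    \<comment> \<open>The only multiple of \<open>I\<close> of absolute value below \<open>I\<close>
      is 0, so within one period the impulse acts at \<open>j = i\<close> alone.\<close>
    with i have "\<bar>j - i\<bar> < I" by auto
    then have "(j - i) mod I = 0 \<longleftrightarrow> j = i"
      by (metis mod_0_imp_dvd dvd_imp_le_int abs_le_zero_iff not_le abs_of_nonneg abs_ge_zero
          order.strict_trans1 eq_iff_diff_eq_0 less_imp_le mod_0 diff_self)
    then show "(mu (j - i - 1) - mu (j - i)) * N j = N j / I - (if j = i then N j else 0)"
      by (simp add: mu_diff left_diff_distrib)
  qed
  also have "\<dots> = (\<Sum>j=1..I. N j) / I - N i"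
    using i by (simp add: sum_subtractf sum_divide_distrib)
  finally show "mu_conv (i + 1) = mu_conv i + (\<Sum>j=1..I. N j) / I - N i" by simp
qed

lemma sum_mu_conv: "(\<Sum>i=1..I. mu_conv i) = 0"
proof -
  have "(\<Sum>i=1..I. mu_conv i) = (\<Sum>j=1..I. (\<Sum>i=1..I. mu (j - i)) * N j)"
    unfolding mu_conv_def sum_distrib_right by (rule sum.swap)
  then show ?thesis by (simp add: sum_periodic_reflect[OF mu_periodic I_ge_1] sum_mu)
qed

section \<open>Identification of the minimizers\<close>

lemma mu_splitting_iff:
  "mu_splitting I mu N c (P, M) \<longleftrightarrow> M = (\<lambda>i. c + mu_conv i) \<and> P = (\<lambda>i. N i - (c + mu_conv i))"
  (is "?L \<longleftrightarrow> ?R")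
proof -
  have per: "periodic_fun_simple (\<lambda>i. c + mu_conv i) I" "periodic_fun_simple (\<lambda>i. N i - (c + mu_conv i)) I"
    by (intro periodic_fun_simpleI;
      simp add: periodic_fun_simple.plus_period[OF N_periodic]
        periodic_fun_simple.plus_period[OF mu_conv_periodic])+
  show ?thesis
  proof
    assume ?L
    then have *: "periodic_fun_simple P I" "periodic_fun_simple M I"
      "\<And>i. i \<in> {1..I} \<Longrightarrow> M i = c + mu_conv i" "\<And>i. i \<in> {1..I} \<Longrightarrow> P i = N i - (c + mu_conv i)"
      by (auto simp: mu_splitting_def mu_conv_def)
    then show ?R
      using periodic_fun_eqI[OF *(2) per(1) I_ge_1] periodic_fun_eqI[OF *(1) per(2) I_ge_1] by auto
  next
    assume ?R
    then show ?L using per by (auto simp: mu_splitting_def mu_conv_def)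
  qed
qed

lemma equal_jumps_iff_mu_splitting:
  "splitting I N (P, M) \<and> equal_jumps P M \<longleftrightarrow> (\<exists>c. mu_splitting I mu N c (P, M))"
proof safe
  assume spl: "splitting I N (P, M)" and eq: "equal_jumps P M"
  \<comment> \<open>\<open>M\<close> and \<open>mu_conv\<close> satisfy the same first-order
    recurrence, so their difference is shift invariant. Its value at 0 serves as
    \<open>c\<close>.\<close>
  have "M (i + 1) - mu_conv (i + 1) = M i - mu_conv i" for i
    using eq[unfolded equal_jumps_def, rule_format, of i] splitting_eq[OF spl, of i] mu_conv_step[of i]
    by simp
  then have *: "M i = (M 0 - mu_conv 0) + mu_conv i" for i
    using shift_invariant_int_const[of "\<lambda>i. M i - mu_conv i" i] by simp
  moreover have "P i = N i - ((M 0 - mu_conv 0) + mu_conv i)" for i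
    using splitting_eq[OF spl, of i] *[of i] by simp
  ultimately have "mu_splitting I mu N (M 0 - mu_conv 0) (P, M)"
    unfolding mu_splitting_iff by blast
  then show "\<exists>c. mu_splitting I mu N c (P, M)" ..
next
  fix c assume *: "mu_splitting I mu N c (P, M)"
  then show "splitting I N (P, M)" by (simp add: mu_splitting_def splitting_def)
  from * show "equal_jumps P M" by (simp add: mu_splitting_iff equal_jumps_def mu_conv_step)
qed

lemma minimizing_splitting_iff_equal_jumps:
  "minimizing_splitting I N (P, M) \<longleftrightarrow> splitting I N (P, M) \<and> equal_jumps P M"
proof -
  \<comment> \<open>This witness shows that the lower bound is attained. A minimizer, known only to
    do at least as well as every other splitting, must then attain it too.\<close>
  obtain P0 M0 where "mu_splitting I mu N 0 (P0, M0)" by (simp add: mu_splitting_iff)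
  then have spl0: "splitting I N (P0, M0)" and "equal_jumps P0 M0"
    using equal_jumps_iff_mu_splitting by blast+
  then have min0: "jump_functional I (P0, M0) = (\<Sum>i=1..I. N i)\<^sup>2 / I"
    by (simp add: jump_functional_eq_iff)
  show ?thesis
  proof safe
    assume min: "minimizing_splitting I N (P, M)"
    then show spl: "splitting I N (P, M)" by (simp add: minimizing_splitting_def is_arg_min_def)
    have "jump_functional I (P, M) \<le> jump_functional I (P0, M0)"
      using min spl0 by (auto simp: minimizing_splitting_def is_arg_min_def not_less)
    then have "jump_functional I (P, M) = (\<Sum>i=1..I. N i)\<^sup>2 / I"
      using jump_functional_ge[OF spl] min0 by simp
    then show "equal_jumps P M" by (simp add: jump_functional_eq_iff[OF spl])
  next
    assume spl: "splitting I N (P, M)" and "equal_jumps P M"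
    then have "jump_functional I (P, M) = (\<Sum>i=1..I. N i)\<^sup>2 / I"
      by (simp add: jump_functional_eq_iff)
    then show "minimizing_splitting I N (P, M)"
      using spl jump_functional_ge
      by (auto simp: minimizing_splitting_def is_arg_min_def not_less)
  qed
qed

lemma minimizing_splitting_iff_mu_splitting:
  "minimizing_splitting I N (P, M) \<longleftrightarrow> (\<exists>c. mu_splitting I mu N c (P, M))"
  by (simp add: minimizing_splitting_iff_equal_jumps equal_jumps_iff_mu_splitting)

text \<open>As \<open>mu_conv\<close> has zero sum, only the constant contributes; orthogonality to
  the constant vector thus singles out \<open>c = 0\<close>.\<close>

lemma mu_splitting_cyclic_inner:
  assumes "mu_splitting I mu N c (P, M)"
  shows "cyclic_inner I M (\<lambda>_. 1) = real_of_int I * c"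
  using assms I_ge_1 by (simp add: mu_splitting_iff cyclic_inner_def sum.distrib sum_mu_conv)

lemma minimizing_orthogonal_iff:
  "minimizing_splitting I N (P, M) \<and> cyclic_inner I M (\<lambda>_. 1) = 0 \<longleftrightarrow> mu_splitting I mu N 0 (P, M)"
proof -
  have "c = 0" if "mu_splitting I mu N c (P, M)" "cyclic_inner I M (\<lambda>_. 1) = 0" for c
    using mu_splitting_cyclic_inner[OF that(1)] that(2) I_ge_1 by simp
  then show ?thesis
    unfolding minimizing_splitting_iff_mu_splitting using mu_splitting_cyclic_inner by fastforce
qed

lemma minimizing_transmitted:
  assumes "minimizing_splitting I N (P, M)"
  shows "- M (i + 1) - P (i - 1) = N i - 2 / I * (\<Sum>j=1..I. N j)"
proof -
  from assms have spl: "splitting I N (P, M)" and eq: "\<And>i. P i + M (i + 1) = (\<Sum>j=1..I. N j) / I"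
    by (simp_all add: minimizing_splitting_iff_equal_jumps equal_jumps_def)
  \<comment> \<open>The two equations sum to \<open>M (i + 1) + P (i - 1) + (P i + M i)\<close>,
    which equals twice the mean jump, and \<open>P i + M i\<close> is \<open>N i\<close>.\<close>
  from eq[of i] eq[of "i - 1"] splitting_eq[OF spl, of i] show ?thesis by simp
qed

end

end

theorem mainTheorem3:
  fixes I :: int and N mu :: "int \<Rightarrow> real"
  assumes "I \<ge> 3"
    and "periodic_fun_simple N I"
    and "periodic_fun_simple mu I"
    and "\<forall>k\<in>{0..I - 1}. mu k = (real_of_int I - 1) / (2 * real_of_int I) - real_of_int k / real_of_int I"
  shows
    "(\<forall>P M. minimizing_splitting I N (P, M) \<longleftrightarrow> (\<exists>c. mu_splitting I mu N c (P, M)))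
     \<and> (\<exists>!(P, M). minimizing_splitting I N (P, M) \<and> cyclic_inner I M (\<lambda>_. 1) = 0)
     \<and> (\<forall>P M. minimizing_splitting I N (P, M) \<and> cyclic_inner I M (\<lambda>_. 1) = 0
            \<longleftrightarrow> mu_splitting I mu N 0 (P, M))
     \<and> (\<forall>P M. minimizing_splitting I N (P, M) \<longrightarrow>
          (\<forall>i\<in>{1..I}. - M (i + 1) - P (i - 1) = N i - 2 / real_of_int I * (\<Sum>i'=1..I. N i')))"
proof -
  have I: "I \<ge> 1" using assms(1) by simp
  note hyps = I assms(2-4)
  \<comment> \<open>For fixed \<open>c\<close>, \<open>mu_splitting_iff\<close> determines both
    functions on all integers, which makes the pair unique. The explicit \<open>0 +\<close> is the
    constant \<open>c\<close> in that form.\<close>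
  have "\<exists>!(P, M). mu_splitting I mu N 0 (P, M)"
    by (rule ex1I[of _ "(\<lambda>i. N i - (0 + mu_conv I N mu i), \<lambda>i. 0 + mu_conv I N mu i)"])
      (auto simp: mu_splitting_iff[OF hyps])
  then show ?thesis
    using minimizing_splitting_iff_mu_splitting[OF hyps] minimizing_orthogonal_iff[OF hyps]
      minimizing_transmitted[OF hyps]
    by auto
qed

end
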